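(* Let $(G,d)$ be a $p$-uniformly convex space with constant $c>0$, let $D\subset G$ and let $T_1,T_2:D\to G$. (i) If $\operatorname{Fix}T_2\cap\operatorname{Fix}T_1\neq\emptyset$, then any convex combination of $T_2$ and $T_1$ is pointwise nonexpansive at $y\in\operatorname{Fix}T_2\cap\operatorname{Fix}T_1$ on $D$ whenever $T_2$ and $T_1$ are pointwise nonexpansive there (at $y$ on $D$). (ii) When $(G,d)$ is a CAT(0) space (that is, $p=2$ and $c=2$), any convex combination of $T_2$ and $T_1$ is pointwise nonexpansive at $y\in D$ on $D$ whenever $T_2$ and $T_1$ are pointwise nonexpansive there (at $y$ on $D$). (iii) For $D_1:=\{T_1y: y\in D\}$ let (instead) $T_2:D_1\to G$ be pointwise nonexpansive at $T_1y\in D_1$ on $D_1$, and let $T_1$ be pointwise nonexpansive at $y\in D$ on $D$. Then the composition $T_2\circ T_1$ is pointwise nonexpansive at $y$ on $D$. In particular, the set of all nonexpansive operators on a CAT(0) space is closed under compositions and convex combinations.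
   Context: Let $p\in(1,\infty)$. A metric space $(G,d)$ is $p$-uniformly convex with constant $c>0$ if it is a geodesic space and for all $x,y,z\in G$, $t\in[0,1]$: $$d(z,(1-t)x\oplus ty)^p\le(1-t)d(z,x)^p+td(z,y)^p-\tfrac c2t(1-t)d(x,y)^p,$$ where $(1-t)x\oplus ty$ is the point on the (unique) geodesic joining $x$ and $y$ at distance $t\,d(x,y)$ from $x$. A CAT(0) space is a $2$-uniformly convex space with constant $c=2$. A convex combination of $T_2$ and $T_1$ is a mapping $x\mapsto(1-\lambda)T_2x\oplus\lambda T_1x$ with $\lambda\in[0,1]$. $T$ is pointwise nonexpansive at $y\in D$ on $D$ if $d(Tx,Ty)\le d(x,y)$ for all $x\in D$, and nonexpansive if this holds at all $y$ in its domain. $\operatorname{Fix}T=\{x:Tx=x\}$. *)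

theory Defs
  imports "HOL-Analysis.Analysis"
begin

text \<open>A unit-speed geodesic path from \<open>x\<close> to \<open>y\<close>, parametrised on \<open>[0, d x y]\<close>; values of
  \<open>\<gamma>\<close> outside this interval are irrelevant.\<close>

definition geodesic_path ::
    "'a set \<Rightarrow> ('a \<Rightarrow> 'a \<Rightarrow> real) \<Rightarrow> (real \<Rightarrow> 'a) \<Rightarrow> 'a \<Rightarrow> 'a \<Rightarrow> bool" where
  "geodesic_path G d \<gamma> x y \<longleftrightarrow>
     \<gamma> \<in> {0..d x y} \<rightarrow> G \<and> \<gamma> 0 = x \<and> \<gamma> (d x y) = y \<and>
     (\<forall>s\<in>{0..d x y}. \<forall>t\<in>{0..d x y}. d (\<gamma> s) (\<gamma> t) = \<bar>s - t\<bar>)"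

locale geodesic_space = Metric_space G d
  for G :: "'a set" and d :: "'a \<Rightarrow> 'a \<Rightarrow> real" +
  assumes geodesic_exists: "\<And>x y. x \<in> G \<Longrightarrow> y \<in> G \<Longrightarrow> \<exists>\<gamma>. geodesic_path G d \<gamma> x y"

text \<open>The point \<open>(1 - t) x \<oplus> t y\<close>. The description is meaningful when the geodesic
  joining \<open>x\<close> and \<open>y\<close> is unique, which is the case in \<open>p\<close>-uniformly convex spaces
  (\<open>geodesic_unique\<close> and \<open>geod_comb_eq\<close> below).\<close>

definition geod_comb :: "'a set \<Rightarrow> ('a \<Rightarrow> 'a \<Rightarrow> real) \<Rightarrow> real \<Rightarrow> 'a \<Rightarrow> 'a \<Rightarrow> 'a" where
  "geod_comb G d t x y = (THE w. \<exists>\<gamma>. geodesic_path G d \<gamma> x y \<and> w = \<gamma> (t * d x y))"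

text \<open>The inequality is imposed along every geodesic from \<open>x\<close> to \<open>y\<close>, so that it makes sense
  before uniqueness of geodesics is known; uniqueness is then a consequence, and the inequality
  is the usual one for \<open>(1 - t) x \<oplus> t y\<close> (\<open>p_uniformly_convex_iff\<close> below).\<close>

locale p_uniformly_convex = geodesic_space G d
  for G :: "'a set" and d :: "'a \<Rightarrow> 'a \<Rightarrow> real" and p c :: real +
  assumes p_gt_1: "1 < p" and c_pos: "0 < c"
    and convexity: "\<And>x y z t \<gamma>. \<lbrakk>x \<in> G; y \<in> G; z \<in> G; 0 \<le> t; t \<le> 1; geodesic_path G d \<gamma> x y\<rbrakk>
      \<Longrightarrow> d z (\<gamma> (t * d x y)) powr p
        \<le> (1 - t) * d z x powr p + t * d z y powr p - c / 2 * t * (1 - t) * d x y powr p"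

locale CAT0_space = p_uniformly_convex G d 2 2
  for G :: "'a set" and d :: "'a \<Rightarrow> 'a \<Rightarrow> real"

definition conv_comb ::
    "'b set \<Rightarrow> ('b \<Rightarrow> 'b \<Rightarrow> real) \<Rightarrow> real \<Rightarrow> ('a \<Rightarrow> 'b) \<Rightarrow> ('a \<Rightarrow> 'b) \<Rightarrow> 'a \<Rightarrow> 'b" where
  "conv_comb G d l T2 T1 = (\<lambda>x. geod_comb G d l (T2 x) (T1 x))"

definition pointwise_nonexpansive ::
    "('a \<Rightarrow> 'a \<Rightarrow> real) \<Rightarrow> 'a set \<Rightarrow> ('a \<Rightarrow> 'a) \<Rightarrow> 'a \<Rightarrow> bool" where
  "pointwise_nonexpansive d D T y \<longleftrightarrow> (\<forall>x\<in>D. d (T x) (T y) \<le> d x y)"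

definition nonexpansive :: "('a \<Rightarrow> 'a \<Rightarrow> real) \<Rightarrow> 'a set \<Rightarrow> ('a \<Rightarrow> 'a) \<Rightarrow> bool" where
  "nonexpansive d D T \<longleftrightarrow> (\<forall>y\<in>D. pointwise_nonexpansive d D T y)"

definition nonexpansive_operators :: "'a set \<Rightarrow> ('a \<Rightarrow> 'a \<Rightarrow> real) \<Rightarrow> ('a \<Rightarrow> 'a) set" where
  "nonexpansive_operators G d = {T. T \<in> G \<rightarrow> G \<and> nonexpansive d G T}"

definition Fix :: "'a set \<Rightarrow> ('a \<Rightarrow> 'a) \<Rightarrow> 'a set" where
  "Fix D T = {x \<in> D. T x = x}"

lemma scaled_in_interval:
  fixes t L :: real
  assumes "0 \<le> t" "t \<le> 1" "0 \<le> L"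
  shows "t * L \<in> {0..L}"
  using assms by (simp add: mult_left_le_one_le)

lemma (in Metric_space) geodesic_path_dist:
  assumes "geodesic_path M d \<gamma> x y" "0 \<le> t" "t \<le> 1"
  shows "\<gamma> (t * d x y) \<in> M"
    and "d x (\<gamma> (t * d x y)) = t * d x y"
    and "d y (\<gamma> (t * d x y)) = (1 - t) * d x y"
proof -
  have t: "t * d x y \<in> {0..d x y}"
    using scaled_in_interval assms nonneg by blast
  have e: "0 \<in> {0..d x y}" "d x y \<in> {0..d x y}" by auto
  show "\<gamma> (t * d x y) \<in> M"
    using assms(1) t unfolding geodesic_path_def by blast
  have "d (\<gamma> 0) (\<gamma> (t * d x y)) = \<bar>0 - t * d x y\<bar>"
    using assms(1) t e(1) unfolding geodesic_path_def by blast
  then show "d x (\<gamma> (t * d x y)) = t * d x y"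
    using assms(1) t unfolding geodesic_path_def by simp
  have "d (\<gamma> (d x y)) (\<gamma> (t * d x y)) = \<bar>d x y - t * d x y\<bar>"
    using assms(1) t e(2) unfolding geodesic_path_def by blast
  then show "d y (\<gamma> (t * d x y)) = (1 - t) * d x y"
    using assms(1) t unfolding geodesic_path_def by (simp add: algebra_simps)
qed

context p_uniformly_convex
begin

lemma geodesic_unique:
  assumes xy: "x \<in> G" "y \<in> G" and t: "0 \<le> t" "t \<le> 1"
    and g: "geodesic_path G d \<gamma> x y" and h: "geodesic_path G d \<eta> x y"
  shows "\<gamma> (t * d x y) = \<eta> (t * d x y)"
proof (rule ccontr)
  define w v where "w = \<gamma> (t * d x y)" and "v = \<eta> (t * d x y)"
  assume "\<gamma> (t * d x y) \<noteq> \<eta> (t * d x y)"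
  then have ne: "w \<noteq> v" by (simp add: w_def v_def)
  have w: "w \<in> G" "d x w = t * d x y" "d y w = (1 - t) * d x y"
    using geodesic_path_dist[OF g t] by (simp_all add: w_def)
  have v: "v \<in> G" "d x v = t * d x y" "d y v = (1 - t) * d x y"
    using geodesic_path_dist[OF h t] by (simp_all add: v_def)
  have pos: "0 < d w v" using ne w(1) v(1) by (simp add: order_less_le)
  obtain \<sigma> where s: "geodesic_path G d \<sigma> w v"
    using geodesic_exists[OF w(1) v(1)] by blast
  define n where "n = \<sigma> ((1/2) * d w v)"
  have n: "n \<in> G" using geodesic_path_dist(1)[OF s, of "1/2"] by (simp add: n_def)
  have drop: "0 < c / 2 * (1/2) * (1 - 1/2) * d w v powr p" using c_pos pos by simp
  have closer: "d z n < r" if z: "z \<in> G" and "d z w = r" "d z v = r" for z r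
  proof (rule ccontr)
    assume "\<not> d z n < r"
    moreover have "0 \<le> r" using that(2) nonneg by blast
    ultimately have "r powr p \<le> d z n powr p"
      using p_gt_1 by (intro powr_mono2) auto
    moreover have "d z n powr p
        \<le> (1 - 1/2) * r powr p + 1/2 * r powr p - c / 2 * (1/2) * (1 - 1/2) * d w v powr p"
      using convexity[OF w(1) v(1) z _ _ s, of "1/2"] that(2,3) by (simp add: n_def)
    ultimately show False using drop by simp
  qed
  have "d x n < t * d x y" "d y n < (1 - t) * d x y"
    using closer xy w v by blast+
  moreover have "d x y \<le> d x n + d y n"
    using triangle[OF xy(1) n xy(2)] commute[of n y] by simp
  ultimately show False by (simp add: algebra_simps)
qed

lemma geod_comb_eq:
  assumes "x \<in> G" "y \<in> G" "0 \<le> t" "t \<le> 1" "geodesic_path G d \<gamma> x y"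
  shows "geod_comb G d t x y = \<gamma> (t * d x y)"
  unfolding geod_comb_def
  by (rule the_equality) (use assms geodesic_unique in blast)+

end

lemma p_uniformly_convex_iff:
  "p_uniformly_convex G d p c \<longleftrightarrow>
     geodesic_space G d \<and> 1 < p \<and> 0 < c \<and>
     (\<forall>x\<in>G. \<forall>y\<in>G. \<forall>t\<in>{0..1}. \<forall>\<gamma> \<eta>. geodesic_path G d \<gamma> x y \<longrightarrow> geodesic_path G d \<eta> x y
        \<longrightarrow> \<gamma> (t * d x y) = \<eta> (t * d x y)) \<and>
     (\<forall>x\<in>G. \<forall>y\<in>G. \<forall>z\<in>G. \<forall>t\<in>{0..1}.
        d z (geod_comb G d t x y) powr p
          \<le> (1 - t) * d z x powr p + t * d z y powr p - c / 2 * t * (1 - t) * d x y powr p)"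
    (is "?L \<longleftrightarrow> ?A \<and> 1 < p \<and> 0 < c \<and> ?U \<and> ?I")
proof
  assume ?L
  then interpret p_uniformly_convex G d p c .
  have ?U using geodesic_unique by simp
  moreover have ?I
  proof (intro ballI)
    fix x y z t assume a: "x \<in> G" "y \<in> G" "z \<in> G" "t \<in> {0..1::real}"
    then have t: "0 \<le> t" "t \<le> 1" by auto
    obtain \<gamma> where g: "geodesic_path G d \<gamma> x y" using geodesic_exists a by blast
    show "d z (geod_comb G d t x y) powr p
        \<le> (1 - t) * d z x powr p + t * d z y powr p - c / 2 * t * (1 - t) * d x y powr p"
      using convexity[OF a(1-3) t g] geod_comb_eq[OF a(1,2) t g] by simp
  qed
  ultimately show "?A \<and> 1 < p \<and> 0 < c \<and> ?U \<and> ?I"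
    using geodesic_space_axioms p_gt_1 c_pos by blast
next
  assume R: "?A \<and> 1 < p \<and> 0 < c \<and> ?U \<and> ?I"
  then interpret geodesic_space G d by blast
  show ?L
  proof
    show "1 < p" "0 < c" using R by auto
    fix x y z t \<gamma>
    assume a: "x \<in> G" "y \<in> G" "z \<in> G" "0 \<le> t" "t \<le> (1::real)" "geodesic_path G d \<gamma> x y"
    have "geod_comb G d t x y = \<gamma> (t * d x y)"
      unfolding geod_comb_def
    proof (rule the_equality)
      fix w assume "\<exists>\<eta>. geodesic_path G d \<eta> x y \<and> w = \<eta> (t * d x y)"
      then obtain \<eta> where "geodesic_path G d \<eta> x y" "w = \<eta> (t * d x y)" by blast
      moreover have "t \<in> {0..1}" using a by simp
      ultimately show "w = \<gamma> (t * d x y)" using R a(1,2,6) by blast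
    qed (use a in blast)
    moreover have "t \<in> {0..1}" using a by simp
    then have "d z (geod_comb G d t x y) powr p
        \<le> (1 - t) * d z x powr p + t * d z y powr p - c / 2 * t * (1 - t) * d x y powr p"
      using R a(1-3) by blast
    ultimately show "d z (\<gamma> (t * d x y)) powr p
        \<le> (1 - t) * d z x powr p + t * d z y powr p - c / 2 * t * (1 - t) * d x y powr p"
      by simp
  qed
qed

end

theory Submission
  imports Defs
begin

text \<open>
  For (i), put the common fixed point into the \<open>z\<close>-slot of the uniform convexity inequality.
  For (ii), the CAT(0) metric is jointly convex along geodesics: applying the quadratic inequality
  twice shows that \<open>(1 - t) x \<oplus> t y\<close> and \<open>(1 - t) x \<oplus> t y'\<close> are at distance at most \<open>t d(y, y')\<close>, the
  contributions of \<open>d(x, y)\<^sup>2\<close> and \<open>d(x, y')\<^sup>2\<close> cancelling exactly; moving the other endpoint in the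
  same way and using the triangle inequality gives the claim.
\<close>

context p_uniformly_convex
begin

text \<open>Geodesics exist and \<open>geod_comb_eq\<close> identifies the description with the
  point at parameter \<open>t * d x y\<close> on any of them, so facts about paths transfer to
  \<open>geod_comb\<close>.\<close>

lemma geod_comb_dist:
  assumes "x \<in> G" "y \<in> G" "0 \<le> t" "t \<le> 1"
  shows geod_comb_closed: "geod_comb G d t x y \<in> G"
    and dist_geod_comb_left: "d x (geod_comb G d t x y) = t * d x y"
    and dist_geod_comb_right: "d y (geod_comb G d t x y) = (1 - t) * d x y"
proof -
  obtain \<gamma> where \<gamma>: "geodesic_path G d \<gamma> x y"
    using geodesic_exists assms by blast
  show "geod_comb G d t x y \<in> G"
    and "d x (geod_comb G d t x y) = t * d x y"
    and "d y (geod_comb G d t x y) = (1 - t) * d x y"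
    using geodesic_path_dist[OF \<gamma> assms(3,4)] geod_comb_eq[OF assms \<gamma>] by simp_all
qed

lemma geod_comb_convexity:
  assumes "x \<in> G" "y \<in> G" "z \<in> G" "0 \<le> t" "t \<le> 1"
  shows "d z (geod_comb G d t x y) powr p
    \<le> (1 - t) * d z x powr p + t * d z y powr p - c / 2 * t * (1 - t) * d x y powr p"
proof -
  obtain \<gamma> where \<gamma>: "geodesic_path G d \<gamma> x y"
    using geodesic_exists assms by blast
  show ?thesis
    using convexity[OF assms \<gamma>] geod_comb_eq[OF assms(1,2,4,5) \<gamma>] by simp
qed

lemma geod_comb_self:
  assumes "x \<in> G" "0 \<le> t" "t \<le> 1"
  shows "geod_comb G d t x x = x"
  using geod_comb_closed[of x x t] dist_geod_comb_left[of x x t] assms by simp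

text \<open>Closed balls are geodesically convex: discarding the nonnegative term with
  \<open>c\<close> leaves convexity of \<open>d z _ powr p\<close>, and the \<open>p\<close>-th
  power is monotone on nonnegative reals.\<close>

lemma dist_geod_comb_le:
  assumes "x \<in> G" "y \<in> G" "z \<in> G" "0 \<le> t" "t \<le> 1" and r: "d z x \<le> r" "d z y \<le> r"
  shows "d z (geod_comb G d t x y) \<le> r"
proof -
  let ?w = "geod_comb G d t x y"
  have "0 \<le> r" using r(1) nonneg[of z x] by linarith
  have "d z ?w powr p
      \<le> (1 - t) * d z x powr p + t * d z y powr p - c / 2 * t * (1 - t) * d x y powr p"
    by (rule geod_comb_convexity) fact+
  also have "\<dots> \<le> (1 - t) * d z x powr p + t * d z y powr p"
    using assms(4,5) c_pos by simp
  also have "\<dots> \<le> (1 - t) * r powr p + t * r powr p"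
    using assms(4,5) r p_gt_1 nonneg by (intro add_mono mult_left_mono powr_mono2) auto
  finally have "d z ?w powr p \<le> r powr p" by (simp add: algebra_simps)
  \<comment> \<open>Since 0 \<le> \<open>r\<close>, a distance exceeding \<open>r\<close> would have
    a strictly larger \<open>p\<close>-th power.\<close>
  then show ?thesis
    using p_gt_1 \<open>0 \<le> r\<close> powr_less_mono2[of p r "d z ?w"] by linarith
qed

text \<open>Because \<open>y\<close> is fixed by both maps, \<open>T1 x\<close> and
  \<open>T2 x\<close> lie in the ball of radius \<open>d x y\<close> about the single centre
  \<open>y\<close>; convexity of that ball keeps their combination inside, and the combined map also
  fixes \<open>y\<close>.\<close>

lemma pointwise_nonexpansive_conv_comb_Fix:
  assumes "D \<subseteq> G" "T1 \<in> D \<rightarrow> G" "T2 \<in> D \<rightarrow> G" "0 \<le> l" "l \<le> 1"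
    and y: "y \<in> Fix D T2 \<inter> Fix D T1"
    and "pointwise_nonexpansive d D T2 y" "pointwise_nonexpansive d D T1 y"
  shows "pointwise_nonexpansive d D (conv_comb G d l T2 T1) y"
  unfolding pointwise_nonexpansive_def
proof
  fix x assume x: "x \<in> D"
  have fixed: "T1 y = y" "T2 y = y" and "y \<in> G"
    using y assms(1) by (auto simp: Fix_def)
  have "conv_comb G d l T2 T1 y = y"
    using \<open>y \<in> G\<close> assms(4,5) by (simp add: conv_comb_def fixed geod_comb_self)
  moreover have "d y (T2 x) \<le> d x y" "d y (T1 x) \<le> d x y"
    using assms(7,8) x fixed by (simp_all add: pointwise_nonexpansive_def commute)
  then have "d y (conv_comb G d l T2 T1 x) \<le> d x y"
    unfolding conv_comb_def using assms(2-5) x \<open>y \<in> G\<close> by (intro dist_geod_comb_le) auto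
  ultimately show "d (conv_comb G d l T2 T1 x) (conv_comb G d l T2 T1 y) \<le> d x y"
    by (simp add: commute)
qed

end

context CAT0_space
begin

lemma CAT0_inequality:
  assumes "x \<in> G" "y \<in> G" "z \<in> G" "0 \<le> t" "t \<le> 1"
  shows "(d z (geod_comb G d t x y))\<^sup>2
    \<le> (1 - t) * (d z x)\<^sup>2 + t * (d z y)\<^sup>2 - t * (1 - t) * (d x y)\<^sup>2"
  using geod_comb_convexity[OF assms] by simp

lemma dist_geod_comb_same_left:
  assumes "x \<in> G" "y \<in> G" "y' \<in> G" "0 \<le> t" "t \<le> 1"
  shows "d (geod_comb G d t x y) (geod_comb G d t x y') \<le> t * d y y'"
proof -
  let ?u = "geod_comb G d t x y" and ?v = "geod_comb G d t x y'"
  have u: "?u \<in> G" "d ?u x = t * d x y"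
    using geod_comb_closed dist_geod_comb_left assms by (simp_all add: commute)
  \<comment> \<open>First use: the geodesic from \<open>x\<close> to \<open>y'\<close>, seen from
    \<open>?u\<close>.\<close>
  have "(d ?u ?v)\<^sup>2 \<le> (1 - t) * (t * d x y)\<^sup>2 + t * (d ?u y')\<^sup>2 - t * (1 - t) * (d x y')\<^sup>2"
    using CAT0_inequality[OF assms(1,3) u(1) assms(4,5)] by (simp add: u(2))
  \<comment> \<open>Second use: the geodesic from \<open>x\<close> to \<open>y\<close>, seen from
    \<open>y'\<close>, scaled by \<open>t\<close> to match the term above.\<close>
  moreover have "t * (d ?u y')\<^sup>2
      \<le> t * ((1 - t) * (d x y')\<^sup>2 + t * (d y y')\<^sup>2 - t * (1 - t) * (d x y)\<^sup>2)"
    using CAT0_inequality[OF assms(1-5)] assms(4) by (intro mult_left_mono) (simp_all add: commute)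
  \<comment> \<open>The term in \<open>d x y\<close> enters with \<open>t * t * (1 - t)\<close> and
    the one in \<open>d x y'\<close> with \<open>t * (1 - t)\<close>, each once with either sign;
    this balance relies on \<open>c / 2 = 1\<close>.\<close>
  ultimately have "(d ?u ?v)\<^sup>2 \<le> (t * d y y')\<^sup>2"
    by (simp add: power2_eq_square algebra_simps)
  then show ?thesis
    using assms(4) by (intro power2_le_imp_le[of "d ?u ?v"]) simp_all
qed

text \<open>The mirror argument with the weights \<open>t\<close> and \<open>1 - t\<close>
  exchanged, carried out directly instead of reversing geodesics.\<close>

lemma dist_geod_comb_same_right:
  assumes "x \<in> G" "x' \<in> G" "y \<in> G" "0 \<le> t" "t \<le> 1"
  shows "d (geod_comb G d t x y) (geod_comb G d t x' y) \<le> (1 - t) * d x x'"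
proof -
  let ?u = "geod_comb G d t x y" and ?v = "geod_comb G d t x' y"
  have u: "?u \<in> G" "d ?u y = (1 - t) * d x y"
    using geod_comb_closed dist_geod_comb_right assms by (simp_all add: commute)
  have "(d ?u ?v)\<^sup>2
      \<le> (1 - t) * (d ?u x')\<^sup>2 + t * ((1 - t) * d x y)\<^sup>2 - t * (1 - t) * (d x' y)\<^sup>2"
    using CAT0_inequality[OF assms(2,3) u(1) assms(4,5)] by (simp add: u(2))
  moreover have "(1 - t) * (d ?u x')\<^sup>2
      \<le> (1 - t) * ((1 - t) * (d x x')\<^sup>2 + t * (d x' y)\<^sup>2 - t * (1 - t) * (d x y)\<^sup>2)"
    using CAT0_inequality[OF assms(1,3,2,4,5)] assms(5)
    by (intro mult_left_mono) (simp_all add: commute)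
  ultimately have "(d ?u ?v)\<^sup>2 \<le> ((1 - t) * d x x')\<^sup>2"
    by (simp add: power2_eq_square algebra_simps)
  then show ?thesis
    using assms(5) by (intro power2_le_imp_le[of "d ?u ?v"]) simp_all
qed

lemma dist_geod_comb_geod_comb:
  assumes "x \<in> G" "x' \<in> G" "y \<in> G" "y' \<in> G" "0 \<le> t" "t \<le> 1"
  shows "d (geod_comb G d t x y) (geod_comb G d t x' y') \<le> (1 - t) * d x x' + t * d y y'"
proof -
  \<comment> \<open>The intermediate point shares \<open>y\<close> with the first combination and
    \<open>x'\<close> with the second, so each leg moves one endpoint only.\<close>
  have "d (geod_comb G d t x y) (geod_comb G d t x' y')
      \<le> d (geod_comb G d t x y) (geod_comb G d t x' y)
        + d (geod_comb G d t x' y) (geod_comb G d t x' y')"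
    using assms by (intro triangle geod_comb_closed)
  then show ?thesis
    using dist_geod_comb_same_left[of x' y y' t] dist_geod_comb_same_right[of x x' y t] assms
    by linarith
qed

text \<open>Joint convexity compares the combinations at \<open>x\<close> and \<open>y\<close>
  directly, so \<open>T1 y\<close> and \<open>T2 y\<close> may differ; both distances are at most
  \<open>d x y\<close> and the weights sum to one.\<close>

lemma pointwise_nonexpansive_conv_comb:
  assumes "T1 \<in> D \<rightarrow> G" "T2 \<in> D \<rightarrow> G" "0 \<le> l" "l \<le> 1" "y \<in> D"
    and "pointwise_nonexpansive d D T2 y" "pointwise_nonexpansive d D T1 y"
  shows "pointwise_nonexpansive d D (conv_comb G d l T2 T1) y"
  unfolding pointwise_nonexpansive_def
proof
  fix x assume x: "x \<in> D"
  have "d (conv_comb G d l T2 T1 x) (conv_comb G d l T2 T1 y)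
      \<le> (1 - l) * d (T2 x) (T2 y) + l * d (T1 x) (T1 y)"
    unfolding conv_comb_def using assms(1-5) x by (intro dist_geod_comb_geod_comb) auto
  also have "\<dots> \<le> (1 - l) * d x y + l * d x y"
    using assms(3,4,6,7) x
    by (intro add_mono mult_left_mono) (auto simp: pointwise_nonexpansive_def)
  finally show "d (conv_comb G d l T2 T1 x) (conv_comb G d l T2 T1 y) \<le> d x y"
    by (simp add: algebra_simps)
qed

lemma conv_comb_nonexpansive_operators:
  assumes "S \<in> nonexpansive_operators G d" "T \<in> nonexpansive_operators G d" "0 \<le> l" "l \<le> 1"
  shows "conv_comb G d l T S \<in> nonexpansive_operators G d"
proof -
  have "conv_comb G d l T S \<in> G \<rightarrow> G"
    using assms geod_comb_closed
    by (auto simp: conv_comb_def nonexpansive_operators_def Pi_iff)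
  then show ?thesis
    using assms pointwise_nonexpansive_conv_comb
    by (auto simp: nonexpansive_operators_def nonexpansive_def)
qed

end

lemma pointwise_nonexpansive_comp:
  assumes "pointwise_nonexpansive d (T1 ` D) T2 (T1 y)" "pointwise_nonexpansive d D T1 y"
  shows "pointwise_nonexpansive d D (T2 \<circ> T1) y"
  unfolding pointwise_nonexpansive_def
proof
  fix x assume "x \<in> D"
  then have "d (T2 (T1 x)) (T2 (T1 y)) \<le> d (T1 x) (T1 y)" "d (T1 x) (T1 y) \<le> d x y"
    using assms by (simp_all add: pointwise_nonexpansive_def)
  then show "d ((T2 \<circ> T1) x) ((T2 \<circ> T1) y) \<le> d x y" by simp
qed

lemma nonexpansive_operators_comp:
  assumes "S \<in> nonexpansive_operators G d" "T \<in> nonexpansive_operators G d"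
  shows "T \<circ> S \<in> nonexpansive_operators G d"
proof -
  have "S ` G \<subseteq> G" using assms(1) by (auto simp: nonexpansive_operators_def)
  \<comment> \<open>Nonexpansiveness of \<open>T\<close> on \<open>G\<close> restricts to the image
    of \<open>S\<close>, the domain on which composition tests the outer map.\<close>
  then have "pointwise_nonexpansive d (S ` G) T (S y)" if "y \<in> G" for y
    using assms(2) that
    by (simp add: nonexpansive_operators_def nonexpansive_def pointwise_nonexpansive_def
        image_subset_iff)
  then have "pointwise_nonexpansive d G (T \<circ> S) y" if "y \<in> G" for y
    using assms(1) that
    by (intro pointwise_nonexpansive_comp) (auto simp: nonexpansive_operators_def nonexpansive_def)
  then show ?thesis
    using assms by (auto simp: nonexpansive_operators_def nonexpansive_def)
qed

theorem theorem8:
  fixes G :: "'a set" and d :: "'a \<Rightarrow> 'a \<Rightarrow> real" and p c :: real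
    and D :: "'a set" and T1 :: "'a \<Rightarrow> 'a"
  assumes "p_uniformly_convex G d p c"
    and "D \<subseteq> G"
    and "T1 \<in> D \<rightarrow> G"
  shows
    "(\<forall>T2\<in>D \<rightarrow> G. Fix D T2 \<inter> Fix D T1 \<noteq> {} \<longrightarrow>
        (\<forall>y\<in>Fix D T2 \<inter> Fix D T1.
           pointwise_nonexpansive d D T2 y \<and> pointwise_nonexpansive d D T1 y \<longrightarrow>
           (\<forall>l\<in>{0..1}. pointwise_nonexpansive d D (conv_comb G d l T2 T1) y)))
     \<and>
     (CAT0_space G d \<longrightarrow>
        (\<forall>T2\<in>D \<rightarrow> G. \<forall>y\<in>D.
           pointwise_nonexpansive d D T2 y \<and> pointwise_nonexpansive d D T1 y \<longrightarrow>
           (\<forall>l\<in>{0..1}. pointwise_nonexpansive d D (conv_comb G d l T2 T1) y)))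
     \<and>
     (\<forall>T2\<in>(T1 ` D) \<rightarrow> G. \<forall>y\<in>D.
        pointwise_nonexpansive d (T1 ` D) T2 (T1 y) \<and> pointwise_nonexpansive d D T1 y \<longrightarrow>
        pointwise_nonexpansive d D (T2 \<circ> T1) y)
     \<and>
     (CAT0_space G d \<longrightarrow>
        (\<forall>S\<in>nonexpansive_operators G d. \<forall>T\<in>nonexpansive_operators G d.
           T \<circ> S \<in> nonexpansive_operators G d \<and>
           (\<forall>l\<in>{0..1}. conv_comb G d l T S \<in> nonexpansive_operators G d)))"
proof (intro conjI)
  interpret p_uniformly_convex G d p c by fact
  show "\<forall>T2\<in>D \<rightarrow> G. Fix D T2 \<inter> Fix D T1 \<noteq> {} \<longrightarrow>
        (\<forall>y\<in>Fix D T2 \<inter> Fix D T1.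
           pointwise_nonexpansive d D T2 y \<and> pointwise_nonexpansive d D T1 y \<longrightarrow>
           (\<forall>l\<in>{0..1}. pointwise_nonexpansive d D (conv_comb G d l T2 T1) y))"
    using pointwise_nonexpansive_conv_comb_Fix[OF assms(2,3)] by simp
next
  show "CAT0_space G d \<longrightarrow>
        (\<forall>T2\<in>D \<rightarrow> G. \<forall>y\<in>D.
           pointwise_nonexpansive d D T2 y \<and> pointwise_nonexpansive d D T1 y \<longrightarrow>
           (\<forall>l\<in>{0..1}. pointwise_nonexpansive d D (conv_comb G d l T2 T1) y))"
    using CAT0_space.pointwise_nonexpansive_conv_comb[OF _ assms(3)] by simp
next
  show "\<forall>T2\<in>(T1 ` D) \<rightarrow> G. \<forall>y\<in>D.
        pointwise_nonexpansive d (T1 ` D) T2 (T1 y) \<and> pointwise_nonexpansive d D T1 y \<longrightarrow>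
        pointwise_nonexpansive d D (T2 \<circ> T1) y"
    by (intro ballI impI) (simp add: pointwise_nonexpansive_comp)
next
  show "CAT0_space G d \<longrightarrow>
        (\<forall>S\<in>nonexpansive_operators G d. \<forall>T\<in>nonexpansive_operators G d.
           T \<circ> S \<in> nonexpansive_operators G d \<and>
           (\<forall>l\<in>{0..1}. conv_comb G d l T S \<in> nonexpansive_operators G d))"
    by (simp add: nonexpansive_operators_comp CAT0_space.conv_comb_nonexpansive_operators)
qed

end
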